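(* Let $G$ be a finite group with odd order, $H$ be a subgroup of $G$ and $A$ be a game subset for $(G,H)$ with $A_0=A\cap H$ the game subset of $H$. The game $\Gamma[A]$ is isomorphic to the lexicographic product $\Gamma[A/H]\ltimes\Gamma[A_0]$. In particular, $Aut(\Gamma[A])$ is isomorphic to the semi-direct product $Aut(\Gamma[A/H])\ltimes Aut(\Gamma[A_0])^{G/H}$.
   Context: For a finite group $G$ of odd order with identity $e$, a game subset is $A\subset G$ such that $G$ is the disjoint union $A\cup A^{-1}\cup\{e\}$ (for the trivial group, $A=\emptyset$), and $\Gamma[A]=\{(i,j)\in G\times G:i^{-1}j\in A\}$, a regular tournament on $G$ (a "game"). For a subgroup $H$, $A$ is a game subset for $(G,H)$ if it is a game subset of $G$ and $i\in A\setminus H$ implies $HiH\subset A$. Then $G/H$ is the set of left cosets, $A/H=\{iH:iH\subset A\}$, and $\Gamma[A/H]=\{(iH,jH):i^{-1}jH\in A/H\}$, a game on $G/H$. Isomorphisms of digraphs are bijections of vertices preserving edges in both directions; $Aut$ denotes the automorphism group. For digraphs $\Gamma$ on $I$ and $\Pi$ on $J$, the lexicographic product $\Gamma\ltimes\Pi$ is the digraph on $I\times J$ with $(p_1,p_2)\to(q_1,q_2)$ iff either $p_1\to q_1$ in $\Gamma$, or $p_1=q_1$ and $p_2\to q_2$ in $\Pi$. For a group $K$ and a group $T$ of permutations of a set $X$, $T\ltimes K^X$ is the set $T\times K^X$ with multiplication $(\rho_1,\gamma_1)(\rho_2,\gamma_2)=(\rho_1\circ\rho_2,(\gamma_1\circ\rho_2)\gamma_2)$,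 where $(\gamma\circ\rho)_x=\gamma_{\rho(x)}$ and the product in $K^X$ is pointwise (the wreath product). *)

theory Defs
  imports
    "HOL-Algebra.Left_Coset"
    "HOL-Algebra.Bij"
    "HOL-Algebra.Product_Groups"
    "Graph_Theory.Pair_Digraph"
    "Graph_Theory.Digraph_Isomorphism"
begin

section \<open>Isomorphisms, automorphisms and lexicographic products of digraphs\<close>

definition isomorphisms :: "'a pair_pre_digraph \<Rightarrow> 'b pair_pre_digraph \<Rightarrow> ('a \<Rightarrow> 'b) set" where
  "isomorphisms \<Gamma> \<Delta> = {f. bij_betw f (pverts \<Gamma>) (pverts \<Delta>) \<and>
     (\<forall>x\<in>pverts \<Gamma>. \<forall>y\<in>pverts \<Gamma>. (x, y) \<in> parcs \<Gamma> \<longleftrightarrow> (f x, f y) \<in> parcs \<Delta>)}"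

definition isomorphic :: "'a pair_pre_digraph \<Rightarrow> 'b pair_pre_digraph \<Rightarrow> bool" where
  "isomorphic \<Gamma> \<Delta> \<longleftrightarrow> isomorphisms \<Gamma> \<Delta> \<noteq> {}"

text \<open>On digraphs whose arcs are pairs of vertices this is the notion of \<open>Graph_Theory\<close>.\<close>

lemma isomorphic_iff_digraph_iso:
  assumes "pair_wf_digraph \<Gamma>" "pair_wf_digraph \<Delta>"
  shows "isomorphic \<Gamma> \<Delta> \<longleftrightarrow> digraph_iso (with_proj \<Gamma>) (with_proj \<Delta>)"
proof
  interpret \<Gamma>: pair_wf_digraph \<Gamma> by fact
  interpret \<Delta>: pair_wf_digraph \<Delta> by fact
  {
    assume "isomorphic \<Gamma> \<Delta>"
    then obtain f where f: "bij_betw f (pverts \<Gamma>) (pverts \<Delta>)"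
      "\<And>x y. x \<in> pverts \<Gamma> \<Longrightarrow> y \<in> pverts \<Gamma> \<Longrightarrow> (x, y) \<in> parcs \<Gamma> \<longleftrightarrow> (f x, f y) \<in> parcs \<Delta>"
      by (auto simp: isomorphic_def isomorphisms_def)
    let ?h = "\<lparr>iso_verts = f, iso_arcs = map_prod f f, iso_head = snd, iso_tail = fst\<rparr>"
    have inj: "inj_on f (pverts \<Gamma>)" and im: "f ` pverts \<Gamma> = pverts \<Delta>"
      using f(1) by (auto simp: bij_betw_def)
    have sub: "parcs \<Gamma> \<subseteq> pverts \<Gamma> \<times> pverts \<Gamma>"
      by (auto dest: \<Gamma>.wellformed')
    have "inj_on (map_prod f f) (parcs \<Gamma>)"
      by (rule inj_on_subset[OF map_prod_inj_on[OF inj inj] sub])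
    then have 1: "pre_digraph.digraph_isomorphism (with_proj \<Gamma>) ?h"
      using inj by (auto simp: pre_digraph.digraph_isomorphism_def \<Gamma>.wf_digraph)
    have "map_prod f f ` parcs \<Gamma> = parcs \<Delta>"
    proof (intro subset_antisym subsetI)
      fix e assume "e \<in> map_prod f f ` parcs \<Gamma>"
      then show "e \<in> parcs \<Delta>" using f(2) by (auto dest: \<Gamma>.wellformed')
    next
      fix e assume e: "e \<in> parcs \<Delta>"
      obtain u v where uv: "e = (u, v)" by (cases e)
      then obtain x y where "x \<in> pverts \<Gamma>" "y \<in> pverts \<Gamma>" "u = f x" "v = f y"
        using im \<Delta>.wellformed' e by blast
      then show "e \<in> map_prod f f ` parcs \<Gamma>" using f(2) uv e by force
    qed
    with im have "with_proj \<Delta> = app_iso ?h (with_proj \<Gamma>)"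
      by (simp add: app_iso_def with_proj_def)
    with 1 show "digraph_iso (with_proj \<Gamma>) (with_proj \<Delta>)"
      unfolding digraph_iso_def by blast
  }
  {
    assume "digraph_iso (with_proj \<Gamma>) (with_proj \<Delta>)"
    then obtain h where h: "pre_digraph.digraph_isomorphism (with_proj \<Gamma>) h"
      and eq: "with_proj \<Delta> = app_iso h (with_proj \<Gamma>)"
      unfolding digraph_iso_def by blast
    have inj: "inj_on (iso_verts h) (pverts \<Gamma>)"
      using h by (simp add: pre_digraph.digraph_isomorphism_def)
    have im: "pverts \<Delta> = iso_verts h ` pverts \<Gamma>" and arcs: "parcs \<Delta> = iso_arcs h ` parcs \<Gamma>"
      and tl: "iso_tail h = fst" and hd: "iso_head h = snd"
      using eq by (simp_all add: app_iso_def with_proj_def)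
    have ia: "iso_arcs h (x, y) = (iso_verts h x, iso_verts h y)" if "(x, y) \<in> parcs \<Gamma>" for x y
      using h that by (force simp: pre_digraph.digraph_isomorphism_def tl hd prod_eq_iff)
    have "(x, y) \<in> parcs \<Gamma> \<longleftrightarrow> (iso_verts h x, iso_verts h y) \<in> parcs \<Delta>"
      if xy: "x \<in> pverts \<Gamma>" "y \<in> pverts \<Gamma>" for x y
    proof
      assume "(x, y) \<in> parcs \<Gamma>"
      then show "(iso_verts h x, iso_verts h y) \<in> parcs \<Delta>" using ia arcs by force
    next
      assume "(iso_verts h x, iso_verts h y) \<in> parcs \<Delta>"
      then obtain u v where "(u, v) \<in> parcs \<Gamma>" "iso_verts h u = iso_verts h x"
        "iso_verts h v = iso_verts h y"
        using ia arcs by force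
      then show "(x, y) \<in> parcs \<Gamma>" using inj xy \<Gamma>.wellformed' by (metis inj_onD)
    qed
    with inj im have "iso_verts h \<in> isomorphisms \<Gamma> \<Delta>"
      by (auto simp: isomorphisms_def bij_betw_def)
    then show "isomorphic \<Gamma> \<Delta>" by (auto simp: isomorphic_def)
  }
qed

text \<open>As in \<^const>\<open>BijGroup\<close>, automorphisms are \<^const>\<open>undefined\<close> outside the vertex set, so that
  each one is represented by exactly one function; the product is composition.\<close>

definition Aut :: "'a pair_pre_digraph \<Rightarrow> ('a \<Rightarrow> 'a) monoid" where
  "Aut \<Gamma> = BijGroup (pverts \<Gamma>) \<lparr>carrier := Bij (pverts \<Gamma>) \<inter> isomorphisms \<Gamma> \<Gamma>\<rparr>"

definition lex_prod :: "'a pair_pre_digraph \<Rightarrow> 'b pair_pre_digraph \<Rightarrow> ('a \<times> 'b) pair_pre_digraph"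
    (infixr \<open>\<ltimes>\<close> 70) where
  "\<Gamma> \<ltimes> \<Delta> = \<lparr>pverts = pverts \<Gamma> \<times> pverts \<Delta>,
     parcs = {((p\<^sub>1, p\<^sub>2), (q\<^sub>1, q\<^sub>2)) | p\<^sub>1 p\<^sub>2 q\<^sub>1 q\<^sub>2.
       (p\<^sub>1, p\<^sub>2) \<in> pverts \<Gamma> \<times> pverts \<Delta> \<and> (q\<^sub>1, q\<^sub>2) \<in> pverts \<Gamma> \<times> pverts \<Delta> \<and>
       ((p\<^sub>1, q\<^sub>1) \<in> parcs \<Gamma> \<or> p\<^sub>1 = q\<^sub>1 \<and> (p\<^sub>2, q\<^sub>2) \<in> parcs \<Delta>)}\<rparr>"


section \<open>The semi-direct product of a permutation group with a power\<close>

text \<open>\<open>T\<close> is meant to be a group of permutations of \<open>X\<close>, with composition as product.\<close>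

definition semidirect_power :: "('x \<Rightarrow> 'x) monoid \<Rightarrow> 'x set \<Rightarrow> 'k monoid \<Rightarrow>
    (('x \<Rightarrow> 'x) \<times> ('x \<Rightarrow> 'k)) monoid" where
  "semidirect_power T X K = \<lparr>
     carrier = carrier T \<times> carrier (product_group X (\<lambda>_. K)),
     monoid.mult = (\<lambda>(\<rho>\<^sub>1, \<gamma>\<^sub>1) (\<rho>\<^sub>2, \<gamma>\<^sub>2).
       (\<rho>\<^sub>1 \<otimes>\<^bsub>T\<^esub> \<rho>\<^sub>2, compose X \<gamma>\<^sub>1 \<rho>\<^sub>2 \<otimes>\<^bsub>product_group X (\<lambda>_. K)\<^esub> \<gamma>\<^sub>2)),
     one = (\<one>\<^bsub>T\<^esub>, \<one>\<^bsub>product_group X (\<lambda>_. K)\<^esub>)\<rparr>"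


section \<open>Games on groups and on coset spaces\<close>

definition game_subset :: "('a, 'b) monoid_scheme \<Rightarrow> 'a set \<Rightarrow> bool" where
  "game_subset G A \<longleftrightarrow> carrier G = A \<union> set_inv\<^bsub>G\<^esub> A \<union> {\<one>\<^bsub>G\<^esub>} \<and>
     A \<inter> set_inv\<^bsub>G\<^esub> A = {} \<and> \<one>\<^bsub>G\<^esub> \<notin> A \<and> \<one>\<^bsub>G\<^esub> \<notin> set_inv\<^bsub>G\<^esub> A"

definition game :: "('a, 'b) monoid_scheme \<Rightarrow> 'a set \<Rightarrow> 'a pair_pre_digraph" where
  "game G A = \<lparr>pverts = carrier G,
     parcs = {(i, j) | i j. i \<in> carrier G \<and> j \<in> carrier G \<and> inv\<^bsub>G\<^esub> i \<otimes>\<^bsub>G\<^esub> j \<in> A}\<rparr>"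

definition rel_game_subset :: "('a, 'b) monoid_scheme \<Rightarrow> 'a set \<Rightarrow> 'a set \<Rightarrow> bool" where
  "rel_game_subset G H A \<longleftrightarrow> game_subset G A \<and> (\<forall>i\<in>A - H. H <#>\<^bsub>G\<^esub> (i <#\<^bsub>G\<^esub> H) \<subseteq> A)"

definition quotient_subset :: "('a, 'b) monoid_scheme \<Rightarrow> 'a set \<Rightarrow> 'a set \<Rightarrow> 'a set set" where
  "quotient_subset G H A = {i <#\<^bsub>G\<^esub> H | i. i \<in> carrier G \<and> i <#\<^bsub>G\<^esub> H \<subseteq> A}"

definition quotient_game :: "('a, 'b) monoid_scheme \<Rightarrow> 'a set \<Rightarrow> 'a set \<Rightarrow> 'a set pair_pre_digraph" where
  "quotient_game G H A = \<lparr>pverts = lcosets\<^bsub>G\<^esub> H,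
     parcs = {(i <#\<^bsub>G\<^esub> H, j <#\<^bsub>G\<^esub> H) | i j. i \<in> carrier G \<and> j \<in> carrier G \<and>
       (inv\<^bsub>G\<^esub> i \<otimes>\<^bsub>G\<^esub> j) <#\<^bsub>G\<^esub> H \<in> quotient_subset G H A}\<rparr>"

lemma game_subset_Int_subgroup:
  fixes G (structure)
  assumes "group G" "subgroup H G" "game_subset G A"
  shows "game_subset (G\<lparr>carrier := H\<rparr>) (A \<inter> H)"
proof -
  interpret group G by fact
  interpret H: subgroup H G by fact
  have inv: "inv\<^bsub>G\<lparr>carrier := H\<rparr>\<^esub> x = inv x" if "x \<in> H" for x
    using that assms(2) by (simp add: m_inv_consistent)
  have si: "set_inv\<^bsub>G\<lparr>carrier := H\<rparr>\<^esub> (A \<inter> H) = set_inv A \<inter> H"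
  proof (intro subset_antisym subsetI)
    fix x assume "x \<in> set_inv A \<inter> H"
    then obtain a where a: "a \<in> A" "x = inv a" "x \<in> H" by (auto simp: SET_INV_def)
    have "a \<in> carrier G" using a(1) assms(3) by (auto simp: game_subset_def)
    then have "a \<in> H" using a H.m_inv_closed by (metis inv_inv)
    then show "x \<in> set_inv\<^bsub>G\<lparr>carrier := H\<rparr>\<^esub> (A \<inter> H)" using a inv by (auto simp: SET_INV_def)
  qed (auto simp: SET_INV_def inv)
  show ?thesis
    using assms(3) H.subset H.one_closed unfolding game_subset_def si by auto
qed

lemma group_Aut: "group (Aut \<Gamma>)"
proof -
  let ?V = "pverts \<Gamma>"
  interpret B: group "BijGroup ?V" by (rule group_BijGroup)
  have "subgroup (Bij ?V \<inter> isomorphisms \<Gamma> \<Gamma>) (BijGroup ?V)"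
  proof (rule B.subgroupI)
    show "Bij ?V \<inter> isomorphisms \<Gamma> \<Gamma> \<subseteq> carrier (BijGroup ?V)" by (auto simp: BijGroup_def)
    have "(\<lambda>x\<in>?V. x) \<in> Bij ?V \<inter> isomorphisms \<Gamma> \<Gamma>"
      using id_Bij[of ?V] by (auto simp: isomorphisms_def Bij_def)
    then show "Bij ?V \<inter> isomorphisms \<Gamma> \<Gamma> \<noteq> {}" by blast
  next
    fix f assume f: "f \<in> Bij ?V \<inter> isomorphisms \<Gamma> \<Gamma>"
    then have b: "bij_betw f ?V ?V" by (auto simp: Bij_def)
    have i: "inv\<^bsub>BijGroup ?V\<^esub> f = (\<lambda>x\<in>?V. inv_into ?V f x)"
      using f by (simp add: inv_BijGroup)
    have "inv_into ?V f x \<in> ?V \<and> f (inv_into ?V f x) = x" if "x \<in> ?V" for x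
      using b that by (metis bij_betw_imp_surj_on f_inv_into_f inv_into_into)
    then show "inv\<^bsub>BijGroup ?V\<^esub> f \<in> Bij ?V \<inter> isomorphisms \<Gamma> \<Gamma>"
      using f restrict_inv_into_Bij[of f ?V] unfolding i
      by (auto simp: isomorphisms_def Bij_def)
  next
    fix f g assume fg: "f \<in> Bij ?V \<inter> isomorphisms \<Gamma> \<Gamma>" "g \<in> Bij ?V \<inter> isomorphisms \<Gamma> \<Gamma>"
    have "g x \<in> ?V" if "x \<in> ?V" for x
      using fg that by (auto simp: Bij_def bij_betw_def)
    then show "f \<otimes>\<^bsub>BijGroup ?V\<^esub> g \<in> Bij ?V \<inter> isomorphisms \<Gamma> \<Gamma>"
      using fg compose_Bij[of f ?V g]
      by (auto simp: BijGroup_def isomorphisms_def compose_eq Bij_def)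
  qed
  then show ?thesis unfolding Aut_def by (rule B.subgroup_imp_group)
qed

lemma group_semidirect_power:
  assumes "subgroup S (BijGroup X)" "group K"
  shows "group (semidirect_power (BijGroup X\<lparr>carrier := S\<rparr>) X K)"
proof -
  interpret B: group "BijGroup X" by (rule group_BijGroup)
  interpret K: group K by fact
  interpret S: subgroup S "BijGroup X" by fact
  interpret T: group "BijGroup X\<lparr>carrier := S\<rparr>" by (rule B.subgroup_imp_group[OF assms(1)])
  have SB: "\<rho> \<in> Bij X" if "\<rho> \<in> S" for \<rho>
    using S.subset that by (auto simp: BijGroup_def)
  have SX: "\<rho> x \<in> X" if "\<rho> \<in> S" "x \<in> X" for \<rho> x
    using SB[OF that(1)] that(2) by (auto simp: Bij_def bij_betw_def)
  have mul: "\<rho> \<otimes>\<^bsub>BijGroup X\<^esub> \<sigma> = compose X \<rho> \<sigma>" if "\<rho> \<in> S" "\<sigma> \<in> S" for \<rho> \<sigma>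
    using SB that by (simp add: BijGroup_def)
  have mulx: "(\<rho> \<otimes>\<^bsub>BijGroup X\<^esub> \<sigma>) x = \<rho> (\<sigma> x)" if "\<rho> \<in> S" "\<sigma> \<in> S" "x \<in> X" for \<rho> \<sigma> x
    using that by (simp add: mul compose_eq)
  have one: "\<one>\<^bsub>BijGroup X\<^esub> = (\<lambda>x\<in>X. x)" by (simp add: BijGroup_def)
  show ?thesis
  proof (rule groupI)
    fix p q assume "p \<in> carrier (semidirect_power (BijGroup X\<lparr>carrier := S\<rparr>) X K)"
      "q \<in> carrier (semidirect_power (BijGroup X\<lparr>carrier := S\<rparr>) X K)"
    then show "p \<otimes>\<^bsub>semidirect_power (BijGroup X\<lparr>carrier := S\<rparr>) X K\<^esub> q
        \<in> carrier (semidirect_power (BijGroup X\<lparr>carrier := S\<rparr>) X K)"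
      by (auto simp: semidirect_power_def compose_eq SX PiE_iff)
  next
    show "\<one>\<^bsub>semidirect_power (BijGroup X\<lparr>carrier := S\<rparr>) X K\<^esub>
        \<in> carrier (semidirect_power (BijGroup X\<lparr>carrier := S\<rparr>) X K)"
      by (auto simp: semidirect_power_def)
  next
    fix p q r assume "p \<in> carrier (semidirect_power (BijGroup X\<lparr>carrier := S\<rparr>) X K)"
      "q \<in> carrier (semidirect_power (BijGroup X\<lparr>carrier := S\<rparr>) X K)"
      "r \<in> carrier (semidirect_power (BijGroup X\<lparr>carrier := S\<rparr>) X K)"
    then show "p \<otimes>\<^bsub>semidirect_power (BijGroup X\<lparr>carrier := S\<rparr>) X K\<^esub> q
          \<otimes>\<^bsub>semidirect_power (BijGroup X\<lparr>carrier := S\<rparr>) X K\<^esub> r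
        = p \<otimes>\<^bsub>semidirect_power (BijGroup X\<lparr>carrier := S\<rparr>) X K\<^esub>
          (q \<otimes>\<^bsub>semidirect_power (BijGroup X\<lparr>carrier := S\<rparr>) X K\<^esub> r)"
      by (auto simp: semidirect_power_def compose_eq SX PiE_iff K.m_assoc fun_eq_iff compose_def restrict_def mulx
          B.m_assoc S.mem_carrier)
  next
    fix p assume "p \<in> carrier (semidirect_power (BijGroup X\<lparr>carrier := S\<rparr>) X K)"
    then show "\<one>\<^bsub>semidirect_power (BijGroup X\<lparr>carrier := S\<rparr>) X K\<^esub>
        \<otimes>\<^bsub>semidirect_power (BijGroup X\<lparr>carrier := S\<rparr>) X K\<^esub> p = p"
      by (auto simp: semidirect_power_def compose_eq SX PiE_iff fun_eq_iff S.mem_carrier extensional_def)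
  next
    fix p assume "p \<in> carrier (semidirect_power (BijGroup X\<lparr>carrier := S\<rparr>) X K)"
    then obtain \<rho> \<gamma> where p: "p = (\<rho>, \<gamma>)" "\<rho> \<in> S" "\<gamma> \<in> X \<rightarrow>\<^sub>E carrier K"
      by (auto simp: semidirect_power_def)
    define \<sigma> where "\<sigma> = inv\<^bsub>BijGroup X\<^esub> \<rho>"
    have \<sigma>: "\<sigma> \<in> S" "\<sigma> \<otimes>\<^bsub>BijGroup X\<^esub> \<rho> = \<one>\<^bsub>BijGroup X\<^esub>"
      using p(2) S.mem_carrier by (auto simp: \<sigma>_def)
    have \<sigma>\<rho>: "\<sigma> (\<rho> x) = x" if "x \<in> X" for x
      using that fun_cong[OF \<sigma>(2), of x] mul[OF \<sigma>(1) p(2)] by (simp add: one compose_eq)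
    let ?q = "(\<sigma>, \<lambda>x\<in>X. inv\<^bsub>K\<^esub> \<gamma> (\<sigma> x))"
    have "?q \<in> carrier (semidirect_power (BijGroup X\<lparr>carrier := S\<rparr>) X K)"
      using p(3) \<sigma>(1) SX by (auto simp: semidirect_power_def PiE_iff)
    moreover have "?q \<otimes>\<^bsub>semidirect_power (BijGroup X\<lparr>carrier := S\<rparr>) X K\<^esub> p
        = \<one>\<^bsub>semidirect_power (BijGroup X\<lparr>carrier := S\<rparr>) X K\<^esub>"
      using p(2,3) \<sigma> SX
      by (auto simp: semidirect_power_def p(1) compose_eq \<sigma>\<rho> PiE_iff fun_eq_iff)
    ultimately show "\<exists>q\<in>carrier (semidirect_power (BijGroup X\<lparr>carrier := S\<rparr>) X K).
        q \<otimes>\<^bsub>semidirect_power (BijGroup X\<lparr>carrier := S\<rparr>) X K\<^esub> p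
        = \<one>\<^bsub>semidirect_power (BijGroup X\<lparr>carrier := S\<rparr>) X K\<^esub>"
      by blast
  qed
qed

end

theory Submission
  imports Defs
begin

text \<open>The sets \<open>g H\<close> are modules of \<open>\<Gamma>[A]\<close>: a vertex outside such a set is related in the same
  way to all its elements. An automorphism maps them to modules of the same size, and it has to
  permute them: if the image of one overlapped some \<open>g H\<close> without being equal to it, then their
  common part would dominate, or be dominated by, the rest of \<open>g H\<close>. This is impossible inside a game
  \<open>\<Gamma>[B]\<close>, for the dominating part \<open>Y\<close> would satisfy \<open>Y b\<inverse> \<subseteq> Y\<close> for all \<open>b \<in> B\<close>, hence \<open>Y b\<inverse> = Y\<close> by
  finiteness, so that \<open>Y\<close> would be everything.\<close>

section \<open>Automorphism groups of digraphs\<close>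

lemma AutE:
  assumes "f \<in> carrier (Aut \<Gamma>)"
  shows "bij_betw f (pverts \<Gamma>) (pverts \<Gamma>)" "f \<in> extensional (pverts \<Gamma>)"
    "\<And>x. x \<in> pverts \<Gamma> \<Longrightarrow> f x \<in> pverts \<Gamma>"
    "\<And>x y. x \<in> pverts \<Gamma> \<Longrightarrow> y \<in> pverts \<Gamma> \<Longrightarrow> (x, y) \<in> parcs \<Gamma> \<longleftrightarrow> (f x, f y) \<in> parcs \<Gamma>"
  using assms by (auto simp: Aut_def Bij_def isomorphisms_def bij_betw_def)

lemma AutI:
  assumes "bij_betw f (pverts \<Gamma>) (pverts \<Gamma>)" "f \<in> extensional (pverts \<Gamma>)"
    "\<And>x y. x \<in> pverts \<Gamma> \<Longrightarrow> y \<in> pverts \<Gamma> \<Longrightarrow> (x, y) \<in> parcs \<Gamma> \<longleftrightarrow> (f x, f y) \<in> parcs \<Gamma>"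
  shows "f \<in> carrier (Aut \<Gamma>)"
  using assms by (auto simp: Aut_def Bij_def isomorphisms_def)

lemma mult_Aut:
  assumes "f \<in> carrier (Aut \<Gamma>)" "g \<in> carrier (Aut \<Gamma>)"
  shows "f \<otimes>\<^bsub>Aut \<Gamma>\<^esub> g = compose (pverts \<Gamma>) f g"
  using assms by (simp add: Aut_def BijGroup_def)

text \<open>Conjugation by an isomorphism \<open>\<phi>\<close> is the required map. The conjugates
  are restricted to the vertex set so that they are again extensional; this makes \<open>F\<close>
  and \<open>F'\<close> inverse to each other on the carriers.\<close>

lemma Aut_iso_if_isomorphic:
  assumes "isomorphic \<Gamma> \<Delta>"
  shows "Aut \<Gamma> \<cong> Aut \<Delta>"
proof -
  let ?V = "pverts \<Gamma>" and ?W = "pverts \<Delta>"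
  obtain \<phi> where bij: "bij_betw \<phi> ?V ?W"
    and arcs: "\<And>x y. x \<in> ?V \<Longrightarrow> y \<in> ?V \<Longrightarrow> (x, y) \<in> parcs \<Gamma> \<longleftrightarrow> (\<phi> x, \<phi> y) \<in> parcs \<Delta>"
    using assms by (auto simp: isomorphic_def isomorphisms_def)
  define \<psi> where "\<psi> = inv_into ?V \<phi>"
  have bij': "bij_betw \<psi> ?W ?V"
    unfolding \<psi>_def by (rule bij_betw_inv_into[OF bij])
  have \<phi>: "\<phi> x \<in> ?W" "\<psi> (\<phi> x) = x" if "x \<in> ?V" for x
    using bij that by (auto simp: \<psi>_def bij_betw_def)
  have \<psi>: "\<psi> y \<in> ?V" "\<phi> (\<psi> y) = y" if "y \<in> ?W" for y
    using bij bij' that by (auto simp: \<psi>_def bij_betw_def f_inv_into_f)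
  have arcs': "(x, y) \<in> parcs \<Delta> \<longleftrightarrow> (\<psi> x, \<psi> y) \<in> parcs \<Gamma>" if "x \<in> ?W" "y \<in> ?W" for x y
    using arcs[of "\<psi> x" "\<psi> y"] \<psi> that by simp
  define F where "F f = (\<lambda>y\<in>?W. \<phi> (f (\<psi> y)))" for f
  define F' where "F' g = (\<lambda>x\<in>?V. \<psi> (g (\<phi> x)))" for g
  have F: "F f \<in> carrier (Aut \<Delta>)" if "f \<in> carrier (Aut \<Gamma>)" for f
  proof (rule AutI)
    have "bij_betw (\<phi> \<circ> (f \<circ> \<psi>)) ?W ?W"
      by (rule bij_betw_trans[OF bij_betw_trans[OF bij' AutE(1)[OF that]] bij])
    then show "bij_betw (F f) ?W ?W"
      by (rule iffD1[OF bij_betw_cong, rotated]) (simp add: F_def)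
    show "F f \<in> extensional ?W"
      by (simp add: F_def)
    show "(x, y) \<in> parcs \<Delta> \<longleftrightarrow> (F f x, F f y) \<in> parcs \<Delta>" if "x \<in> ?W" "y \<in> ?W" for x y
      using that AutE[OF \<open>f \<in> carrier (Aut \<Gamma>)\<close>] \<psi> by (simp add: F_def arcs' flip: arcs)
  qed
  have F': "F' g \<in> carrier (Aut \<Gamma>)" if "g \<in> carrier (Aut \<Delta>)" for g
  proof (rule AutI)
    have "bij_betw (\<psi> \<circ> (g \<circ> \<phi>)) ?V ?V"
      by (rule bij_betw_trans[OF bij_betw_trans[OF bij AutE(1)[OF that]] bij'])
    then show "bij_betw (F' g) ?V ?V"
      by (rule iffD1[OF bij_betw_cong, rotated]) (simp add: F'_def)
    show "F' g \<in> extensional ?V"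
      by (simp add: F'_def)
    show "(x, y) \<in> parcs \<Gamma> \<longleftrightarrow> (F' g x, F' g y) \<in> parcs \<Gamma>" if "x \<in> ?V" "y \<in> ?V" for x y
      using that AutE[OF \<open>g \<in> carrier (Aut \<Delta>)\<close>] \<phi> by (simp add: F'_def arcs flip: arcs')
  qed
  have "F (f \<otimes>\<^bsub>Aut \<Gamma>\<^esub> g) = F f \<otimes>\<^bsub>Aut \<Delta>\<^esub> F g"
    if "f \<in> carrier (Aut \<Gamma>)" "g \<in> carrier (Aut \<Gamma>)" for f g
    using that F AutE(3)[OF that(2)] \<phi> \<psi>
    by (auto simp: mult_Aut fun_eq_iff F_def compose_def)
  with F have "F \<in> hom (Aut \<Gamma>) (Aut \<Delta>)"
    by (simp add: hom_def)
  moreover have "F' (F f) = f" if "f \<in> carrier (Aut \<Gamma>)" for f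
    using AutE(2,3)[OF that] \<phi> by (auto simp: F_def F'_def fun_eq_iff extensional_def)
  moreover have "F (F' g) = g" if "g \<in> carrier (Aut \<Delta>)" for g
    using AutE(2,3)[OF that] \<psi> by (auto simp: F_def F'_def fun_eq_iff extensional_def)
  ultimately have "F \<in> Group.iso (Aut \<Gamma>) (Aut \<Delta>)"
    using F F' by (auto simp: Group.iso_def intro!: bij_betw_byWitness[where f' = F'])
  then show ?thesis
    by (auto simp: is_iso_def)
qed

section \<open>Automorphisms of a lexicographic product\<close>

lemma pverts_lex_prod [simp]: "pverts (\<Gamma> \<ltimes> \<Delta>) = pverts \<Gamma> \<times> pverts \<Delta>"
  by (simp add: lex_prod_def)

lemma parcs_lex_prod:
  "((p, q), (p', q')) \<in> parcs (\<Gamma> \<ltimes> \<Delta>) \<longleftrightarrow>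
    p \<in> pverts \<Gamma> \<and> q \<in> pverts \<Delta> \<and> p' \<in> pverts \<Gamma> \<and> q' \<in> pverts \<Delta> \<and>
    ((p, p') \<in> parcs \<Gamma> \<or> p = p' \<and> (q, q') \<in> parcs \<Delta>)"
  by (auto simp: lex_prod_def)

text \<open>This is the rigidity of the fibres \<open>{p} \<times> pverts \<Delta>\<close>, which
  yields surjectivity in \<open>Aut_lex_prod\<close>. For a tournament \<open>\<Delta>\<close>, the
  hypothesis \<open>no_cut\<close> amounts to strong connectedness. If the image of a fibre met two
  fibres, then a point of it in one of them would force a forbidden cut of the other.\<close>

lemma Aut_lex_prod_fst_eq:
  assumes irrefl: "\<And>p. (p, p) \<notin> parcs \<Gamma>"
    and total: "\<And>p p'. p \<in> pverts \<Gamma> \<Longrightarrow> p' \<in> pverts \<Gamma> \<Longrightarrow> p \<noteq> p' \<Longrightarrow>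
      (p, p') \<in> parcs \<Gamma> \<or> (p', p) \<in> parcs \<Gamma>"
    and fin: "finite (pverts \<Delta>)"
    and no_cut: "\<And>X Y. X \<union> Y = pverts \<Delta> \<Longrightarrow> X \<inter> Y = {} \<Longrightarrow> X \<noteq> {} \<Longrightarrow> Y \<noteq> {} \<Longrightarrow>
      \<exists>x\<in>X. \<exists>y\<in>Y. (x, y) \<notin> parcs \<Delta>"
    and f: "f \<in> carrier (Aut (\<Gamma> \<ltimes> \<Delta>))"
    and p: "p \<in> pverts \<Gamma>" and q: "q \<in> pverts \<Delta>" "q' \<in> pverts \<Delta>"
  shows "fst (f (p, q)) = fst (f (p, q'))"
proof (rule ccontr)
  assume neq: "fst (f (p, q)) \<noteq> fst (f (p, q'))"
  let ?V = "pverts \<Gamma> \<times> pverts \<Delta>" and ?E = "parcs (\<Gamma> \<ltimes> \<Delta>)"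
  note f = AutE[OF f, unfolded pverts_lex_prod]
  obtain p' r where p'r: "f (p, q) = (p', r)" by force
  obtain s t where st: "f (p, q') = (s, t)" by force
  have mem: "p' \<in> pverts \<Gamma>" "r \<in> pverts \<Delta>" "s \<in> pverts \<Gamma>" "t \<in> pverts \<Delta>"
    using f(3)[of "(p, q)"] f(3)[of "(p, q')"] p q p'r st by auto
  have "s \<noteq> p'" using neq p'r st by simp
  \<comment> \<open>\<open>M\<close> meets the fibre over \<open>p'\<close> in
    \<open>(p', r)\<close> and also contains \<open>(s, t)\<close> from another fibre. It cuts the
    fibre over \<open>p'\<close> into the part \<open>X\<close> inside \<open>M\<close> and the part
    \<open>Y\<close> outside.\<close>
  define M where "M = f ` ({p} \<times> pverts \<Delta>)"
  define X where "X = {x \<in> pverts \<Delta>. (p', x) \<in> M}"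
  define Y where "Y = {x \<in> pverts \<Delta>. (p', x) \<notin> M}"
  have XY: "X \<union> Y = pverts \<Delta>" "X \<inter> Y = {}"
    by (auto simp: X_def Y_def)
  have in_M: "(p', r) \<in> M" "(s, t) \<in> M"
    unfolding M_def p'r[symmetric] st[symmetric] using q by (auto intro!: imageI)
  have "X \<noteq> {}"
    using in_M mem by (auto simp: X_def)
  \<comment> \<open>If \<open>M\<close> contained the whole fibre over \<open>p'\<close>, comparing
    finite cardinalities would make the two equal, leaving no room for
    \<open>(s, t)\<close>.\<close>
  have "Y \<noteq> {}"
  proof
    assume "Y = {}"
    then have "{p'} \<times> pverts \<Delta> \<subseteq> M" by (auto simp: Y_def)
    moreover have "card M \<le> card ({p'} \<times> pverts \<Delta>)"
      using card_image_le[of "{p} \<times> pverts \<Delta>" f] fin by (simp add: M_def card_cartesian_product)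
    moreover have "finite M" using fin by (simp add: M_def)
    ultimately have "M = {p'} \<times> pverts \<Delta>"
      by (metis card_seteq)
    then show False using in_M \<open>s \<noteq> p'\<close> by blast
  qed
  \<comment> \<open>\<open>M\<close> is a module: the preimage of \<open>z\<close> lies over some
    \<open>z1 \<noteq> p\<close>, and arcs between different fibres depend on the first coordinates
    only. One implication suffices in each direction of the arc, since \<open>u\<close> and
    \<open>v\<close> can be exchanged.\<close>
  have "z \<in> ?V \<Longrightarrow> z \<notin> M \<Longrightarrow> u \<in> M \<Longrightarrow> v \<in> M \<Longrightarrow> ((z, u) \<in> ?E \<longrightarrow> (z, v) \<in> ?E) \<and> ((u, z) \<in> ?E \<longrightarrow> (v, z) \<in> ?E)"
    for z u v
  proof -
    assume *: "z \<in> ?V" "z \<notin> M" "u \<in> M" "v \<in> M"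
    have "z \<in> f ` ?V" using *(1) f(1) by (simp add: bij_betw_def)
    then obtain z1 z2 where z: "z = f (z1, z2)" "z1 \<in> pverts \<Gamma>" "z2 \<in> pverts \<Delta>"
      by blast
    from * z have "z1 \<noteq> p" by (auto simp: M_def)
    moreover obtain b c where "u = f (p, b)" "v = f (p, c)" "b \<in> pverts \<Delta>" "c \<in> pverts \<Delta>"
      using *(3,4) by (auto simp: M_def)
    ultimately show ?thesis
      using z p f(4)[of "(z1, z2)" "(p, b)"] f(4)[of "(z1, z2)" "(p, c)"]
        f(4)[of "(p, b)" "(z1, z2)"] f(4)[of "(p, c)" "(z1, z2)"]
      by (simp add: parcs_lex_prod)
  qed
  note module = this
  from total[OF mem(1,3)] \<open>s \<noteq> p'\<close> consider "(s, p') \<in> parcs \<Gamma>" | "(p', s) \<in> parcs \<Gamma>" by blast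
  then show False
  proof cases
    case 1
    \<comment> \<open>The arc from \<open>s\<close> to \<open>p'\<close> gives one from
      \<open>(s, t)\<close> to \<open>(p', y)\<close>. As \<open>(p', y)\<close> is outside the
      module \<open>M\<close>, its tail may be moved from \<open>(s, t)\<close> to
      \<open>(p', x)\<close>, and by irreflexivity of \<open>\<Gamma>\<close> the resulting arc
      comes from \<open>\<Delta>\<close>. The second case is the mirror image.\<close>
    have "(x, y) \<in> parcs \<Delta>" if "x \<in> X" "y \<in> Y" for x y
    proof -
      have "((s, t), (p', y)) \<in> ?E"
        using 1 that mem by (auto simp: parcs_lex_prod Y_def)
      then have "((p', x), (p', y)) \<in> ?E"
        using module[of "(p', y)" "(s, t)" "(p', x)"] in_M that mem by (auto simp: X_def Y_def)
      then show ?thesis using irrefl by (auto simp: parcs_lex_prod)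
    qed
    then show False using no_cut[OF XY] \<open>X \<noteq> {}\<close> \<open>Y \<noteq> {}\<close> by blast
  next
    case 2
    have "(y, x) \<in> parcs \<Delta>" if "x \<in> X" "y \<in> Y" for x y
    proof -
      have "((p', y), (s, t)) \<in> ?E"
        using 2 that mem by (auto simp: parcs_lex_prod Y_def)
      then have "((p', y), (p', x)) \<in> ?E"
        using module[of "(p', y)" "(s, t)" "(p', x)"] in_M that mem by (auto simp: X_def Y_def)
      then show ?thesis using irrefl by (auto simp: parcs_lex_prod)
    qed
    then show False using no_cut[of Y X] XY \<open>X \<noteq> {}\<close> \<open>Y \<noteq> {}\<close> by blast
  qed
qed

text \<open>A pair \<open>(\<rho>, \<gamma>)\<close> acts by
  \<open>(p, q) \<mapsto> (\<rho> p, \<gamma> p q)\<close>. In the composite of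
  \<open>(\<rho>, \<gamma>)\<close> after \<open>(\<sigma>, \<delta>)\<close>, the fibre over
  \<open>p\<close> is first moved by \<open>\<delta> p\<close> and then, lying over
  \<open>\<sigma> p\<close>, by \<open>\<gamma> (\<sigma> p)\<close>; this is the multiplication of
  \<open>semidirect_power\<close>. Every automorphism arises in this way because it permutes the
  fibres.\<close>

theorem Aut_lex_prod:
  assumes irrefl: "\<And>p. (p, p) \<notin> parcs \<Gamma>"
    and total: "\<And>p p'. p \<in> pverts \<Gamma> \<Longrightarrow> p' \<in> pverts \<Gamma> \<Longrightarrow> p \<noteq> p' \<Longrightarrow>
      (p, p') \<in> parcs \<Gamma> \<or> (p', p) \<in> parcs \<Gamma>"
    and fin: "finite (pverts \<Delta>)" and ne: "pverts \<Delta> \<noteq> {}"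
    and no_cut: "\<And>X Y. X \<union> Y = pverts \<Delta> \<Longrightarrow> X \<inter> Y = {} \<Longrightarrow> X \<noteq> {} \<Longrightarrow> Y \<noteq> {} \<Longrightarrow>
      \<exists>x\<in>X. \<exists>y\<in>Y. (x, y) \<notin> parcs \<Delta>"
  shows "semidirect_power (Aut \<Gamma>) (pverts \<Gamma>) (Aut \<Delta>) \<cong> Aut (\<Gamma> \<ltimes> \<Delta>)"
proof -
  let ?V = "pverts \<Gamma>" and ?W = "pverts \<Delta>" and ?S = "semidirect_power (Aut \<Gamma>) (pverts \<Gamma>) (Aut \<Delta>)"
  \<comment> \<open>A base point in the fibres is needed to read off the first component of a pair
    from its action: over an empty \<open>?W\<close> the action would not determine
    \<open>\<rho>\<close>.\<close>
  obtain q0 where q0: "q0 \<in> ?W" using ne by blast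
  define \<Phi> where "\<Phi> = (\<lambda>(\<rho>, \<gamma>). \<lambda>(p, q)\<in>?V \<times> ?W. (\<rho> p :: 'a, \<gamma> p q :: 'b))"
  have \<Phi>: "\<Phi> (\<rho>, \<gamma>) (p, q) = (\<rho> p, \<gamma> p q)" if "p \<in> ?V" "q \<in> ?W" for \<rho> \<gamma> p q
    using that by (simp add: \<Phi>_def)
  have \<Phi>_ext: "\<Phi> x \<in> extensional (?V \<times> ?W)" for x
    by (simp add: \<Phi>_def split: prod.split)
  have S: "carrier ?S = carrier (Aut \<Gamma>) \<times> (?V \<rightarrow>\<^sub>E carrier (Aut \<Delta>))"
    by (simp add: semidirect_power_def)
  have clo: "\<Phi> (\<rho>, \<gamma>) \<in> carrier (Aut (\<Gamma> \<ltimes> \<Delta>))"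
    if \<rho>: "\<rho> \<in> carrier (Aut \<Gamma>)" and \<gamma>: "\<gamma> \<in> ?V \<rightarrow>\<^sub>E carrier (Aut \<Delta>)" for \<rho> \<gamma>
  proof (rule AutI, unfold pverts_lex_prod)
    note \<rho> = AutE[OF \<rho>]
    have "\<gamma> p \<in> carrier (Aut \<Delta>)" if "p \<in> ?V" for p using \<gamma> that by auto
    note \<gamma> = AutE[OF this]
    show "\<Phi> (\<rho>, \<gamma>) \<in> extensional (?V \<times> ?W)" by (rule \<Phi>_ext)
    have inj\<rho>: "\<rho> p = \<rho> p' \<longleftrightarrow> p = p'" if "p \<in> ?V" "p' \<in> ?V" for p p'
      using \<rho>(1) that by (auto simp: bij_betw_def inj_on_def)
    have inj\<gamma>: "\<gamma> p q = \<gamma> p q' \<longleftrightarrow> q = q'" if "p \<in> ?V" "q \<in> ?W" "q' \<in> ?W" for p q q'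
      using \<gamma>(1)[of p] that by (auto simp: bij_betw_def inj_on_def)
    show "bij_betw (\<Phi> (\<rho>, \<gamma>)) (?V \<times> ?W) (?V \<times> ?W)"
    proof (rule bij_betw_imageI)
      show "inj_on (\<Phi> (\<rho>, \<gamma>)) (?V \<times> ?W)"
        by (rule inj_onI) (auto simp: \<Phi> inj\<rho> inj\<gamma>)
      show "\<Phi> (\<rho>, \<gamma>) ` (?V \<times> ?W) = ?V \<times> ?W"
      proof (intro subset_antisym subsetI)
        fix x assume "x \<in> \<Phi> (\<rho>, \<gamma>) ` (?V \<times> ?W)"
        then show "x \<in> ?V \<times> ?W" using \<rho>(3) \<gamma>(3) by (auto simp: \<Phi>)
      next
        fix x assume "x \<in> ?V \<times> ?W"
        then obtain a b where x: "x = (a, b)" "a \<in> ?V" "b \<in> ?W" by blast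
        then obtain p where p: "p \<in> ?V" "a = \<rho> p" using \<rho>(1) by (auto simp: bij_betw_def)
        with x obtain q where q: "q \<in> ?W" "b = \<gamma> p q"
          using \<gamma>(1)[of p] by (auto simp: bij_betw_def)
        with p x show "x \<in> \<Phi> (\<rho>, \<gamma>) ` (?V \<times> ?W)"
          by (intro image_eqI[of _ _ "(p, q)"]) (auto simp: \<Phi>)
      qed
    qed
    fix x y assume "x \<in> ?V \<times> ?W" "y \<in> ?V \<times> ?W"
    then show "(x, y) \<in> parcs (\<Gamma> \<ltimes> \<Delta>) \<longleftrightarrow> (\<Phi> (\<rho>, \<gamma>) x, \<Phi> (\<rho>, \<gamma>) y) \<in> parcs (\<Gamma> \<ltimes> \<Delta>)"
      using \<rho>(3,4) \<gamma>(3,4) inj\<rho> by (auto simp: \<Phi> parcs_lex_prod)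
  qed
  have "\<Phi> (x \<otimes>\<^bsub>?S\<^esub> y) = \<Phi> x \<otimes>\<^bsub>Aut (\<Gamma> \<ltimes> \<Delta>)\<^esub> \<Phi> y"
    if xy: "x \<in> carrier ?S" "y \<in> carrier ?S" for x y
  proof -
    obtain \<rho> \<gamma> \<sigma> \<delta> where x: "x = (\<rho>, \<gamma>)" "\<rho> \<in> carrier (Aut \<Gamma>)" "\<gamma> \<in> ?V \<rightarrow>\<^sub>E carrier (Aut \<Delta>)"
      and y: "y = (\<sigma>, \<delta>)" "\<sigma> \<in> carrier (Aut \<Gamma>)" "\<delta> \<in> ?V \<rightarrow>\<^sub>E carrier (Aut \<Delta>)"
      using xy S by auto
    note \<sigma> = AutE[OF y(2)]
    have *: "\<gamma> p \<in> carrier (Aut \<Delta>)" "\<delta> p \<in> carrier (Aut \<Delta>)" if "p \<in> ?V" for p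
      using x y that by auto
    have "x \<otimes>\<^bsub>?S\<^esub> y = (compose ?V \<rho> \<sigma>, \<lambda>p\<in>?V. compose ?W (\<gamma> (\<sigma> p)) (\<delta> p))"
      using x y \<sigma>(3) * by (auto simp: semidirect_power_def mult_Aut compose_eq fun_eq_iff)
    moreover have "compose (?V \<times> ?W) (\<Phi> x) (\<Phi> y) z =
        \<Phi> (compose ?V \<rho> \<sigma>, \<lambda>p\<in>?V. compose ?W (\<gamma> (\<sigma> p)) (\<delta> p)) z" for z
    proof (cases "z \<in> ?V \<times> ?W")
      case True
      with \<sigma>(3) AutE(3)[OF *(2)] show ?thesis
        by (auto simp: x y compose_eq \<Phi>)
    next
      case False
      then show ?thesis
        by (auto simp: compose_def \<Phi>_def)
    qed
    ultimately show ?thesis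
      using clo x y by (simp add: mult_Aut fun_eq_iff)
  qed
  then have hom: "\<Phi> \<in> hom ?S (Aut (\<Gamma> \<ltimes> \<Delta>))"
    using clo by (auto simp: hom_def S)
  have inj: "inj_on \<Phi> (carrier ?S)"
  proof (rule inj_onI)
    fix x y assume xy: "x \<in> carrier ?S" "y \<in> carrier ?S" and eq: "\<Phi> x = \<Phi> y"
    obtain \<rho> \<gamma> \<sigma> \<delta> where x: "x = (\<rho>, \<gamma>)" "\<rho> \<in> carrier (Aut \<Gamma>)" "\<gamma> \<in> ?V \<rightarrow>\<^sub>E carrier (Aut \<Delta>)"
      and y: "y = (\<sigma>, \<delta>)" "\<sigma> \<in> carrier (Aut \<Gamma>)" "\<delta> \<in> ?V \<rightarrow>\<^sub>E carrier (Aut \<Delta>)"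
      using xy S by auto
    have *: "\<rho> p = \<sigma> p" "\<gamma> p q = \<delta> p q" if "p \<in> ?V" "q \<in> ?W" for p q
      using fun_cong[OF eq, of "(p, q)"] that by (auto simp: x y \<Phi>)
    have "\<rho> = \<sigma>"
      by (rule extensionalityI[OF AutE(2)[OF x(2)] AutE(2)[OF y(2)]]) (use * q0 in auto)
    moreover have "\<gamma> = \<delta>"
    proof (rule PiE_ext[OF x(3) y(3)])
      fix p assume p: "p \<in> ?V"
      then have "\<gamma> p \<in> carrier (Aut \<Delta>)" "\<delta> p \<in> carrier (Aut \<Delta>)" using x y by auto
      then show "\<gamma> p = \<delta> p"
        by (rule extensionalityI[OF AutE(2) AutE(2)]) (use * p in auto)
    qed
    ultimately show "x = y" by (simp add: x y)
  qed
  have "f \<in> \<Phi> ` carrier ?S" if fA: "f \<in> carrier (Aut (\<Gamma> \<ltimes> \<Delta>))" for f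
  proof -
    note f = AutE[OF fA, unfolded pverts_lex_prod]
    have fst_eq: "fst (f (p, q)) = fst (f (p, q'))" if "p \<in> ?V" "q \<in> ?W" "q' \<in> ?W" for p q q'
      by (rule Aut_lex_prod_fst_eq[where \<Gamma> = \<Gamma> and \<Delta> = \<Delta>];
          (rule irrefl fin fA that | (rule total no_cut; assumption)))
    \<comment> \<open>By \<open>fst_eq\<close> the choice of \<open>q0\<close> does not affect
      \<open>\<rho>\<close>.\<close>
    define \<rho> where "\<rho> = (\<lambda>p\<in>?V. fst (f (p, q0)))"
    define \<gamma> where "\<gamma> = (\<lambda>p\<in>?V. \<lambda>q\<in>?W. snd (f (p, q)))"
    have feq: "f (p, q) = (\<rho> p, \<gamma> p q)" if "p \<in> ?V" "q \<in> ?W" for p q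
      using that fst_eq[of p q q0] q0 by (auto simp: \<rho>_def \<gamma>_def prod_eq_iff)
    have mem: "\<rho> p \<in> ?V" "\<gamma> p q \<in> ?W" if "p \<in> ?V" "q \<in> ?W" for p q
      using f(3)[of "(p, q)"] that by (auto simp: feq)
    have f_inj: "p = p' \<and> q = q'"
      if "p \<in> ?V" "q \<in> ?W" "p' \<in> ?V" "q' \<in> ?W" "\<rho> p = \<rho> p'" "\<gamma> p q = \<gamma> p' q'" for p q p' q'
      using inj_onD[OF bij_betw_imp_inj_on[OF f(1)], of "(p, q)" "(p', q')"] that by (simp add: feq)
    \<comment> \<open>Only injectivity is inherited directly from \<open>f\<close>; surjectivity
      onto the fibre comes from finiteness of \<open>?W\<close>.\<close>
    have \<gamma>_bij: "bij_betw (\<gamma> p) ?W ?W" if "p \<in> ?V" for p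
    proof -
      have "inj_on (\<gamma> p) ?W" using f_inj that by (auto simp: inj_on_def)
      moreover have "\<gamma> p ` ?W \<subseteq> ?W" using mem that by auto
      ultimately show ?thesis using fin by (simp add: bij_betw_def endo_inj_surj)
    qed
    \<comment> \<open>Two fibres cannot be sent into the same one: \<open>\<gamma> p'\<close>
      already fills it, so the image of \<open>(p, q0)\<close> would also be the image of a point
      over \<open>p'\<close>.\<close>
    have \<rho>_inj: "p = p'" if "p \<in> ?V" "p' \<in> ?V" "\<rho> p = \<rho> p'" for p p'
    proof -
      have "\<gamma> p q0 \<in> \<gamma> p' ` ?W" using \<gamma>_bij[OF that(2)] mem that q0 by (auto simp: bij_betw_def)
      then show ?thesis using f_inj q0 that by blast
    qed
    have "\<rho> \<in> carrier (Aut \<Gamma>)"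
    proof (rule AutI)
      show "bij_betw \<rho> ?V ?V"
      proof (rule bij_betw_imageI)
        show "inj_on \<rho> ?V" by (rule inj_onI) (rule \<rho>_inj)
        show "\<rho> ` ?V = ?V"
        proof (intro subset_antisym subsetI)
          fix a assume "a \<in> ?V"
          then have "(a, q0) \<in> f ` (?V \<times> ?W)" using f(1) q0 by (auto simp: bij_betw_def)
          then show "a \<in> \<rho> ` ?V" by (auto simp: feq)
        qed (use mem q0 in auto)
      qed
      show "\<rho> \<in> extensional ?V" by (simp add: \<rho>_def)
      fix p p' assume p: "p \<in> ?V" "p' \<in> ?V"
      show "(p, p') \<in> parcs \<Gamma> \<longleftrightarrow> (\<rho> p, \<rho> p') \<in> parcs \<Gamma>"
      \<comment> \<open>For \<open>p \<noteq> p'\<close> injectivity of \<open>\<rho>\<close>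
        excludes the second kind of arc of the product, so arcs between \<open>(p, q0)\<close> and
        \<open>(p', q0)\<close> and between their images are exactly those of
        \<open>\<Gamma>\<close>.\<close>
      proof (cases "p = p'")
        case True
        then show ?thesis using irrefl by simp
      next
        case False
        with \<rho>_inj p have "\<rho> p \<noteq> \<rho> p'" by blast
        with False show ?thesis
          using f(4)[of "(p, q0)" "(p', q0)"] p q0 mem by (simp add: feq parcs_lex_prod)
      qed
    qed
    moreover have "\<gamma> p \<in> carrier (Aut \<Delta>)" if p: "p \<in> ?V" for p
    proof (rule AutI)
      show "bij_betw (\<gamma> p) ?W ?W" by (rule \<gamma>_bij[OF p])
      show "\<gamma> p \<in> extensional ?W" using p by (simp add: \<gamma>_def)
      show "(q, q') \<in> parcs \<Delta> \<longleftrightarrow> (\<gamma> p q, \<gamma> p q') \<in> parcs \<Delta>" if "q \<in> ?W" "q' \<in> ?W" for q q'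
        using f(4)[of "(p, q)" "(p, q')"] p that mem irrefl by (simp add: feq parcs_lex_prod)
    qed
    then have "\<gamma> \<in> ?V \<rightarrow>\<^sub>E carrier (Aut \<Delta>)" by (auto simp: \<gamma>_def)
    moreover have "f = \<Phi> (\<rho>, \<gamma>)"
      by (rule extensionalityI[OF f(2) \<Phi>_ext]) (auto simp: feq \<Phi>)
    ultimately show ?thesis unfolding S by blast
  qed
  with clo have "\<Phi> ` carrier ?S = carrier (Aut (\<Gamma> \<ltimes> \<Delta>))"
    by (auto simp: S)
  with hom inj have "\<Phi> \<in> Group.iso ?S (Aut (\<Gamma> \<ltimes> \<Delta>))"
    by (simp add: Group.iso_def bij_betw_def)
  then show ?thesis by (auto simp: is_iso_def)
qed

section \<open>Strong connectedness of finite games\<close>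

text \<open>This supplies the hypothesis \<open>no_cut\<close> of \<open>Aut_lex_prod\<close>. A
  dominating part \<open>X\<close> contains all predecessors of its elements; by finiteness it then
  contains all successors too, including the elements of \<open>Y\<close> that it dominates.\<close>

lemma game_no_cut:
  fixes G (structure)
  assumes "group G" "finite (carrier G)" "game_subset G A"
    and XY: "X \<union> Y = carrier G" "X \<inter> Y = {}" "X \<noteq> {}" "Y \<noteq> {}"
  shows "\<exists>x\<in>X. \<exists>y\<in>Y. (x, y) \<notin> parcs (game G A)"
proof (rule ccontr)
  assume "\<not> ?thesis"
  then have dom: "inv x \<otimes> y \<in> A" if "x \<in> X" "y \<in> Y" for x y
    using that by (auto simp: game_def)
  interpret group G by fact
  have X: "x \<in> carrier G" if "x \<in> X" for x using that XY by blast
  have AG: "a \<in> carrier G" if "a \<in> A" for a using assms(3) that by (auto simp: game_subset_def)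
  have inv_notin: "inv a \<notin> A" if "a \<in> A" for a
    using assms(3) that by (auto simp: game_subset_def SET_INV_def)
  \<comment> \<open>There is an arc from \<open>x \<otimes> inv a\<close> to \<open>x\<close>. If
    its tail were in \<open>Y\<close>, domination would give the opposite arc as well, that is,
    \<open>inv a \<in> A\<close>.\<close>
  have sub: "x \<otimes> inv a \<in> X" if "x \<in> X" "a \<in> A" for x a
  proof (rule ccontr)
    assume "x \<otimes> inv a \<notin> X"
    then have "x \<otimes> inv a \<in> Y" using XY(1) X[OF that(1)] AG[OF that(2)] by blast
    from dom[OF that(1) this] have "inv a \<in> A"
      using X[OF that(1)] AG[OF that(2)] by (simp add: m_assoc[symmetric])
    then show False using inv_notin that by blast
  qed
  \<comment> \<open>Right multiplication by \<open>inv a\<close> is an injective map of the finite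
    set \<open>X\<close> into itself, hence onto, and \<open>x \<otimes> a\<close> is the preimage
    of \<open>x\<close>.\<close>
  have sup: "x \<otimes> a \<in> X" if "x \<in> X" "a \<in> A" for x a
  proof -
    have "inj_on (\<lambda>x. x \<otimes> inv a) X"
      using X AG[OF that(2)] by (auto simp: inj_on_def)
    moreover have "finite X" using XY(1) assms(2) by (metis finite_Un)
    moreover have "(\<lambda>x. x \<otimes> inv a) ` X \<subseteq> X" using sub that by auto
    ultimately have "(\<lambda>x. x \<otimes> inv a) ` X = X" by (intro endo_inj_surj)
    then have "x \<in> (\<lambda>x. x \<otimes> inv a) ` X" using that by simp
    then obtain x' where x': "x' \<in> X" "x = x' \<otimes> inv a" by blast
    then have "x \<otimes> a = x'" using X AG[OF that(2)] by (simp add: m_assoc)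
    then show ?thesis using x' by simp
  qed
  \<comment> \<open>Domination puts \<open>inv x \<otimes> y\<close> into \<open>A\<close>, and
    right multiplication by this element carries \<open>x\<close> to \<open>y\<close>.\<close>
  obtain x y where xy: "x \<in> X" "y \<in> Y" using XY by blast
  then have "x \<otimes> (inv x \<otimes> y) \<in> X" using sup dom by blast
  moreover have "x \<otimes> (inv x \<otimes> y) = y" using xy XY X by (subst m_assoc[symmetric]) auto
  ultimately show False using xy XY by auto
qed

section \<open>Quotient games and the decomposition of a game\<close>

lemma pverts_game [simp]: "pverts (game G A) = carrier G"
  by (simp add: game_def)

lemma game_arc_iff:
  "(i, j) \<in> parcs (game G A) \<longleftrightarrow> i \<in> carrier G \<and> j \<in> carrier G \<and> inv\<^bsub>G\<^esub> i \<otimes>\<^bsub>G\<^esub> j \<in> A"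
  by (simp add: game_def)

lemma pverts_quotient_game [simp]: "pverts (quotient_game G H A) = lcosets\<^bsub>G\<^esub> H"
  by (simp add: quotient_game_def)

lemma (in group) l_coset_eq_iff:
  assumes H: "subgroup H G" and ij: "i \<in> carrier G" "j \<in> carrier G"
  shows "i <# H = j <# H \<longleftrightarrow> inv i \<otimes> j \<in> H"
proof
  assume "i <# H = j <# H"
  then have "j \<in> i <# H" using lcos_self[OF ij(2) H] by simp
  then show "inv i \<otimes> j \<in> H" using ij subgroup.mem_carrier[OF H]
    by (auto simp: l_coset_def m_assoc[symmetric])
next
  assume *: "inv i \<otimes> j \<in> H"
  have "i \<otimes> (inv i \<otimes> j) = j" using ij by (simp add: m_assoc[symmetric])
  then have "j \<in> i <# H" using * by (force simp: l_coset_def)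
  then show "i <# H = j <# H" using l_repr_independence ij H by blast
qed

text \<open>The arcs of \<open>quotient_game\<close> are defined by the existence of suitable
  representatives. Changing representatives multiplies \<open>inv i \<otimes> j\<close> by elements
  of \<open>H\<close> on both sides, and \<open>A - H\<close> is stable under this by
  \<open>rel_game_subset\<close>; so any representatives decide.\<close>

lemma quotient_game_arc_iff:
  fixes G (structure)
  assumes "group G" "subgroup H G" "rel_game_subset G H A" "i \<in> carrier G" "j \<in> carrier G"
  shows "(i <# H, j <# H) \<in> parcs (quotient_game G H A) \<longleftrightarrow> inv i \<otimes> j \<in> A - H"
proof -
  interpret group G by fact
  interpret H: subgroup H G by fact
  have rel: "h \<otimes> (k \<otimes> h') \<in> A" if "k \<in> A - H" "h \<in> H" "h' \<in> H" for k h h'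
    using assms(3) that unfolding rel_game_subset_def set_mult_def l_coset_def by blast
  have one: "\<one> \<notin> A"
    using assms(3) by (auto simp: rel_game_subset_def game_subset_def)
  \<comment> \<open>A coset inside \<open>A\<close> is not \<open>H\<close> itself, because
    \<open>H\<close> contains \<open>\<one>\<close>. Conversely, \<open>k <# H\<close> is part of
    the double coset of \<open>k\<close>.\<close>
  have key: "k <# H \<subseteq> A \<longleftrightarrow> k \<in> A - H" if k: "k \<in> carrier G" for k
  proof
    assume sub: "k <# H \<subseteq> A"
    have "k \<otimes> \<one> \<in> k <# H" by (auto simp: l_coset_def)
    with sub k have "k \<in> A" by auto
    moreover have "k \<notin> H"
    proof
      assume "k \<in> H"
      then have "k \<otimes> inv k \<in> k <# H" by (simp only: l_coset_def) (blast intro: H.m_inv_closed)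
      with sub k one show False by auto
    qed
    ultimately show "k \<in> A - H" by blast
  next
    assume "k \<in> A - H"
    from rel[OF this, of \<one>] k show "k <# H \<subseteq> A" by (auto simp: l_coset_def)
  qed
  have quot: "k <# H \<in> quotient_subset G H A \<longleftrightarrow> k \<in> A - H" if "k \<in> carrier G" for k
    unfolding key[OF that, symmetric] using that by (auto simp: quotient_subset_def)
  show ?thesis
  proof
    assume "inv i \<otimes> j \<in> A - H"
    then show "(i <# H, j <# H) \<in> parcs (quotient_game G H A)"
      using assms(4,5) quot[of "inv i \<otimes> j"] by (auto simp: quotient_game_def)
  next
    assume "(i <# H, j <# H) \<in> parcs (quotient_game G H A)"
    then obtain i' j' where ij: "i <# H = i' <# H" "j <# H = j' <# H" "i' \<in> carrier G" "j' \<in> carrier G"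
      "(inv i' \<otimes> j') <# H \<in> quotient_subset G H A"
      by (auto simp: quotient_game_def)
    then have k: "inv i' \<otimes> j' \<in> A - H" using quot[of "inv i' \<otimes> j'"] by simp
    have "i \<in> i' <# H" "j \<in> j' <# H"
      using lcos_self[OF _ assms(2)] assms(4,5) ij by auto
    then obtain h h' where h: "h \<in> H" "h' \<in> H" "i = i' \<otimes> h" "j = j' \<otimes> h'"
      by (auto simp: l_coset_def)
    have eq: "inv i \<otimes> j = inv h \<otimes> ((inv i' \<otimes> j') \<otimes> h')"
      using h ij by (simp add: inv_mult_group m_assoc)
    then have "inv i \<otimes> j \<in> A" using rel[OF k, of "inv h" h'] h by simp
    \<comment> \<open>Undoing the change of representatives by \<open>h\<close> and
      \<open>h'\<close> stays within \<open>H\<close> and would lead back to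
      \<open>inv i' \<otimes> j'\<close>.\<close>
    moreover have "inv i \<otimes> j \<notin> H"
    proof
      assume "inv i \<otimes> j \<in> H"
      then have "h \<otimes> (inv i \<otimes> j) \<otimes> inv h' \<in> H" using h by simp
      moreover have "h \<otimes> (inv i \<otimes> j) \<otimes> inv h' = inv i' \<otimes> j'"
      proof -
        let ?k = "inv i' \<otimes> j'"
        have "h \<otimes> (inv h \<otimes> (?k \<otimes> h')) = ?k \<otimes> h'"
          using h ij by (subst m_assoc[symmetric]) auto
        moreover have "?k \<otimes> h' \<otimes> inv h' = ?k"
          using h ij by (subst m_assoc) auto
        ultimately show ?thesis by (simp only: eq)
      qed
      ultimately show False using k by simp
    qed
    ultimately show "inv i \<otimes> j \<in> A - H" by blast
  qed
qed

text \<open>After a choice of coset representatives \<open>r\<close>, an element \<open>i\<close> is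
  recorded by its coset and its position \<open>inv (r (i <# H)) \<otimes> i\<close> in
  \<open>H\<close>. Arcs with \<open>inv i \<otimes> j\<close> in \<open>A - H\<close> are those of
  the quotient game, and arcs with \<open>inv i \<otimes> j\<close> in \<open>A \<inter> H\<close>
  stay inside one coset.\<close>

lemma isomorphic_game_lex_prod:
  fixes G (structure)
  assumes "group G" "subgroup H G" "rel_game_subset G H A"
  shows "isomorphic (game G A) (quotient_game G H A \<ltimes> game (G\<lparr>carrier := H\<rparr>) (A \<inter> H))"
proof -
  interpret group G by fact
  interpret H: subgroup H G by fact
  \<comment> \<open>The representative is a function of the coset, so elements of equal cosets are
    measured from the same point; injectivity of \<open>?f\<close> and the comparison of arcs inside
    a coset rest on this.\<close>
  define r where "r C = (SOME x. x \<in> carrier G \<and> x <# H = C)" for C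
  have r: "r (i <# H) \<in> carrier G" "r (i <# H) <# H = i <# H" if "i \<in> carrier G" for i
    using someI[of "\<lambda>x. x \<in> carrier G \<and> x <# H = i <# H" i] that by (auto simp: r_def)
  have rH: "inv (r (i <# H)) \<otimes> i \<in> H" if "i \<in> carrier G" for i
    using l_coset_eq_iff[OF assms(2)] r that by blast
  let ?f = "\<lambda>i. (i <# H, inv (r (i <# H)) \<otimes> i)"
  have inv_H: "inv\<^bsub>G\<lparr>carrier := H\<rparr>\<^esub> x = inv x" if "x \<in> H" for x
    using that assms(2) by (simp add: m_inv_consistent)
  have "bij_betw ?f (carrier G) ((lcosets H) \<times> H)"
  proof (rule bij_betw_imageI)
    show "inj_on ?f (carrier G)"
      by (rule inj_onI) (use r in auto)
    show "?f ` carrier G = (lcosets H) \<times> H"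
    proof (intro subset_antisym subsetI)
      fix x assume "x \<in> ?f ` carrier G"
      then show "x \<in> (lcosets H) \<times> H" using rH by (auto simp: LCOSETS_def)
    next
      fix x assume "x \<in> (lcosets H) \<times> H"
      then obtain i h where x: "x = (i <# H, h)" "i \<in> carrier G" "h \<in> H" by (auto simp: LCOSETS_def)
      let ?j = "r (i <# H) \<otimes> h"
      have j: "?j \<in> carrier G" "inv (r (i <# H)) \<otimes> ?j = h"
        using r[OF x(2)] x(3) by (auto simp: m_assoc[symmetric])
      then have "?j <# H = i <# H" using l_coset_eq_iff[OF assms(2), of "r (i <# H)" ?j] r[OF x(2)] x(3) by simp
      with j x show "x \<in> ?f ` carrier G" by (intro image_eqI[of _ _ ?j]) auto
    qed
  qed
  moreover have "(i, j) \<in> parcs (game G A) \<longleftrightarrow>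
      (?f i, ?f j) \<in> parcs (quotient_game G H A \<ltimes> game (G\<lparr>carrier := H\<rparr>) (A \<inter> H))"
    if ij: "i \<in> carrier G" "j \<in> carrier G" for i j
  proof -
    have "i <# H \<in> lcosets H" "j <# H \<in> lcosets H"
      using ij by (auto simp: LCOSETS_def)
    then have arc: "(?f i, ?f j) \<in> parcs (quotient_game G H A \<ltimes> game (G\<lparr>carrier := H\<rparr>) (A \<inter> H)) \<longleftrightarrow>
        inv i \<otimes> j \<in> A - H \<or> i <# H = j <# H \<and>
        inv (inv (r (i <# H)) \<otimes> i) \<otimes> (inv (r (j <# H)) \<otimes> j) \<in> A \<inter> H"
      using rH ij by (simp add: parcs_lex_prod game_arc_iff inv_H quotient_game_arc_iff[OF assms])
    \<comment> \<open>This is the form that the second alternative takes once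
      \<open>i <# H = j <# H\<close> has been substituted: left translation by the common
      representative leaves \<open>inv i \<otimes> j\<close> unchanged.\<close>
    have "inv (inv (r (j <# H)) \<otimes> i) \<otimes> (inv (r (j <# H)) \<otimes> j) = inv i \<otimes> j"
    proof -
      have "r (j <# H) \<otimes> (inv (r (j <# H)) \<otimes> j) = j"
        using r[of j] ij by (simp add: m_assoc[symmetric])
      then show ?thesis
        using r[of j] ij by (simp add: inv_mult_group m_assoc)
    qed
    then show ?thesis
      using arc l_coset_eq_iff[OF assms(2) ij] ij by (auto simp: game_arc_iff)
  qed
  ultimately have "?f \<in> isomorphisms (game G A) (quotient_game G H A \<ltimes> game (G\<lparr>carrier := H\<rparr>) (A \<inter> H))"
    by (auto simp: isomorphisms_def)
  then show ?thesis by (auto simp: isomorphic_def)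
qed

lemma quotient_game_irrefl:
  fixes G (structure)
  assumes "group G" "subgroup H G" "rel_game_subset G H A"
  shows "(p, p) \<notin> parcs (quotient_game G H A)"
proof
  interpret group G by fact
  assume p: "(p, p) \<in> parcs (quotient_game G H A)"
  then obtain i where "i \<in> carrier G" "p = i <# H" by (auto simp: quotient_game_def)
  with p show False
    using quotient_game_arc_iff[OF assms, of i i] subgroup.one_closed[OF assms(2)] by simp
qed

text \<open>For distinct cosets \<open>inv i \<otimes> j\<close> is outside \<open>H\<close>, in
  particular not \<open>\<one>\<close>, so it or its inverse \<open>inv j \<otimes> i\<close> lies
  in \<open>A\<close>.\<close>

lemma quotient_game_total:
  fixes G (structure)
  assumes "group G" "subgroup H G" "rel_game_subset G H A"
    and "p \<in> lcosets H" "p' \<in> lcosets H" "p \<noteq> p'"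
  shows "(p, p') \<in> parcs (quotient_game G H A) \<or> (p', p) \<in> parcs (quotient_game G H A)"
proof -
  interpret group G by fact
  obtain i j where ij: "i \<in> carrier G" "j \<in> carrier G" "p = i <# H" "p' = j <# H"
    using assms(4,5) by (auto simp: LCOSETS_def)
  have notin: "inv i \<otimes> j \<notin> H"
    using l_coset_eq_iff[OF assms(2) ij(1,2)] ij assms(6) by simp
  have inv_eq: "inv (inv i \<otimes> j) = inv j \<otimes> i" using ij by (simp add: inv_mult_group)
  have notin': "inv j \<otimes> i \<notin> H"
    using l_coset_eq_iff[OF assms(2) ij(2,1)] ij assms(6) by simp
  have "inv i \<otimes> j \<in> A \<union> set_inv A \<union> {\<one>}"
    using assms(3) ij unfolding rel_game_subset_def game_subset_def by (metis inv_closed m_closed)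
  moreover have "inv i \<otimes> j \<noteq> \<one>" using notin subgroup.one_closed[OF assms(2)] by auto
  moreover have "inv j \<otimes> i \<in> A" if "inv i \<otimes> j \<in> set_inv A"
  proof -
    from that obtain a where a: "a \<in> A" "inv i \<otimes> j = inv a" by (auto simp: SET_INV_def)
    then have "a \<in> carrier G" using assms(3) by (auto simp: rel_game_subset_def game_subset_def)
    with a inv_eq show ?thesis by simp
  qed
  ultimately show ?thesis
    using notin notin' quotient_game_arc_iff[OF assms(1-3)] ij by auto
qed

theorem theorem9p12:
  fixes G :: "('a, 'b) monoid_scheme" and H A :: "'a set"
  assumes "group G" and "finite (carrier G)" and "odd (order G)"
    and "subgroup H G"
    and "rel_game_subset G H A"
  shows "isomorphic (game G A) (quotient_game G H A \<ltimes> game (G\<lparr>carrier := H\<rparr>) (A \<inter> H)) \<and>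
    Aut (game G A) \<cong>
      semidirect_power (Aut (quotient_game G H A)) (lcosets\<^bsub>G\<^esub> H) (Aut (game (G\<lparr>carrier := H\<rparr>) (A \<inter> H)))"
proof
  let ?Q = "quotient_game G H A" and ?N = "game (G\<lparr>carrier := H\<rparr>) (A \<inter> H)"
  let ?S = "semidirect_power (Aut ?Q) (lcosets\<^bsub>G\<^esub> H) (Aut ?N)"
  show iso: "isomorphic (game G A) (?Q \<ltimes> ?N)"
    by (rule isomorphic_game_lex_prod[OF assms(1,4,5)])
  have H: "group (G\<lparr>carrier := H\<rparr>)"
    using group.subgroup_imp_group[OF assms(1,4)] .
  have fin: "finite H"
    using finite_subset[OF subgroup.subset[OF assms(4)] assms(2)] .
  have game: "game_subset (G\<lparr>carrier := H\<rparr>) (A \<inter> H)"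
    using assms(5) game_subset_Int_subgroup[OF assms(1,4)] by (simp add: rel_game_subset_def)
  have "semidirect_power (Aut ?Q) (pverts ?Q) (Aut ?N) \<cong> Aut (?Q \<ltimes> ?N)"
  proof (rule Aut_lex_prod)
    show "(p, p) \<notin> parcs ?Q" for p
      by (rule quotient_game_irrefl[OF assms(1,4,5)])
    show "(p, p') \<in> parcs ?Q \<or> (p', p) \<in> parcs ?Q" if "p \<in> pverts ?Q" "p' \<in> pverts ?Q" "p \<noteq> p'" for p p'
      using quotient_game_total[OF assms(1,4,5)] that by simp
    show "\<exists>x\<in>X. \<exists>y\<in>Y. (x, y) \<notin> parcs ?N"
      if "X \<union> Y = pverts ?N" "X \<inter> Y = {}" "X \<noteq> {}" "Y \<noteq> {}" for X Y
      using game_no_cut[OF H _ game] fin that by simp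
    show "finite (pverts ?N)" "pverts ?N \<noteq> {}"
      using fin subgroup.one_closed[OF assms(4)] by auto
  qed
  then have S_iso: "?S \<cong> Aut (?Q \<ltimes> ?N)" by simp
  \<comment> \<open>Reversing \<open>S_iso\<close> requires its source \<open>?S\<close> to be a
    group. For this, \<open>Aut ?Q\<close> is presented as a subgroup of the group of all
    permutations of the cosets, the form that \<open>group_semidirect_power\<close> expects.\<close>
  interpret B: group "BijGroup (lcosets\<^bsub>G\<^esub> H)"
    by (rule group_BijGroup)
  have Aut_Q: "Aut ?Q = BijGroup (lcosets\<^bsub>G\<^esub> H)\<lparr>carrier := carrier (Aut ?Q)\<rparr>"
    by (simp add: Aut_def)
  have "subgroup (carrier (Aut ?Q)) (BijGroup (lcosets\<^bsub>G\<^esub> H))"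
  proof (rule B.group_incl_imp_subgroup)
    show "carrier (Aut ?Q) \<subseteq> carrier (BijGroup (lcosets\<^bsub>G\<^esub> H))"
      by (auto simp: Aut_def BijGroup_def)
    show "group (BijGroup (lcosets\<^bsub>G\<^esub> H)\<lparr>carrier := carrier (Aut ?Q)\<rparr>)"
      using group_Aut[of ?Q] Aut_Q by simp
  qed
  from group_semidirect_power[OF this group_Aut[of ?N]] have "group ?S"
    using Aut_Q by simp
  then have "Aut (?Q \<ltimes> ?N) \<cong> ?S"
    using S_iso by (rule group.iso_sym)
  with Aut_iso_if_isomorphic[OF iso] show "Aut (game G A) \<cong> ?S"
    by (rule iso_trans)
qed

end
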